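(* Let $n$ and $k$ be positive integers and let $\mathcal{H}$ be a generic $n\times n$ half-grid in $\mathbb{R}^2$ with vertex $V$. Let $\mathrm{cov}_k(\mathcal{H})$ be the minimum size of a finite multiset of lines in $\mathbb{R}^2$, none of which passes through $V$, such that every point of $\mathcal{H}\setminus\{V\}$ lies on at least $k$ of the lines (counted with multiplicity). Then $$\frac{3nk}{2}-2k\ \le\ \mathrm{cov}_k(\mathcal{H})\ \le\ \frac{3nk}{2}+\frac{k}{2}.$$
   Context: Let $S_1=\{a_0<a_1<\cdots<a_{n-1}\}$ and $S_2=\{b_0<b_1<\cdots<b_{n-1}\}$ be sets of $n$ real numbers each. The $n\times n$ half-grid $\mathcal{H}$ defined by $S_1,S_2$ is the set of points $(a_i,b_j)$ with $i,j\ge 0$ and $i+j\le n-1$. Its vertex is $V=(a_0,b_0)$. The half-grid is called generic if every line in $\mathbb{R}^2$ that is parallel to neither the $x$-axis nor the $y$-axis passes through at most $2$ points of $\mathcal{H}$. *)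

theory Defs
  imports "HOL-Analysis.Analysis" "HOL-Library.Multiset"
begin

type_synonym plane = "real \<times> real"

definition half_grid :: "nat \<Rightarrow> (nat \<Rightarrow> real) \<Rightarrow> (nat \<Rightarrow> real) \<Rightarrow> plane set" where
  "half_grid n a b = {(a i, b j) | i j. i + j \<le> n - 1}"

definition is_line :: "plane set \<Rightarrow> bool" where
  "is_line L \<longleftrightarrow> affine L \<and> aff_dim L = 1"

definition x_axis :: "plane set" where
  "x_axis = {p. snd p = 0}"

definition y_axis :: "plane set" where
  "y_axis = {p. fst p = 0}"

text \<open>The library's parallelism counts a line as parallel to itself, as needed here.\<close>

definition generic :: "plane set \<Rightarrow> bool" where
  "generic H \<longleftrightarrow>
     (\<forall>L. is_line L \<and> \<not> affine_parallel L x_axis \<and> \<not> affine_parallel L y_axis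
        \<longrightarrow> card (L \<inter> H) \<le> 2)"

definition is_cover :: "nat \<Rightarrow> plane set \<Rightarrow> plane \<Rightarrow> plane set multiset \<Rightarrow> bool" where
  "is_cover k H V M \<longleftrightarrow>
     (\<forall>L \<in># M. is_line L \<and> V \<notin> L) \<and>
     (\<forall>p \<in> H - {V}. k \<le> size {#L \<in># M. p \<in> L#})"

text \<open>The minimum exists for every finite \<open>H\<close>; see \<open>is_cover_exists\<close> below.\<close>

definition cov :: "nat \<Rightarrow> plane set \<Rightarrow> plane \<Rightarrow> nat" where
  "cov k H V = (LEAST m. \<exists>M. is_cover k H V M \<and> size M = m)"

lemma finite_half_grid: "finite (half_grid n a b)"
proof (rule finite_subset)
  show "half_grid n a b \<subseteq> (\<lambda>(i, j). (a i, b j)) ` ({..n} \<times> {..n})"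
    unfolding half_grid_def by force
qed simp

lemma is_line_hyperplane:
  assumes "u \<noteq> 0"
  shows "is_line {p. u \<bullet> p = c}"
  using assms by (simp add: is_line_def affine_hyperplane)

lemma line_avoiding:
  assumes "p \<noteq> (V :: plane)"
  obtains L where "is_line L" "p \<in> L" "V \<notin> L"
proof
  show "is_line {q. (p - V) \<bullet> q = (p - V) \<bullet> p}"
    using assms by (intro is_line_hyperplane) simp
  have "(p - V) \<bullet> (p - V) \<noteq> 0" using assms by simp
  then show "V \<notin> {q. (p - V) \<bullet> q = (p - V) \<bullet> p}"
    by (simp add: inner_diff_right)
qed simp

lemma is_cover_exists:
  assumes "finite H"
  shows "\<exists>M. is_cover k H V M"
  using assms
proof (induction H rule: finite_induct)
  case empty
  show ?case by (rule exI[of _ "{#}"]) (simp add: is_cover_def)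
next
  case (insert p H)
  then obtain M where M: "is_cover k H V M" by blast
  show ?case
  proof (cases "p = V")
    case True
    with M show ?thesis by (auto simp: is_cover_def)
  next
    case False
    then obtain L where L: "is_line L" "p \<in> L" "V \<notin> L" by (rule line_avoiding)
    have "is_cover k (insert p H) V (M + replicate_mset k L)"
      unfolding is_cover_def
    proof (rule conjI; rule ballI)
      fix K assume "K \<in># M + replicate_mset k L"
      then show "is_line K \<and> V \<notin> K"
        using M L by (auto simp: is_cover_def split: if_splits)
    next
      fix q assume q: "q \<in> insert p H - {V}"
      show "k \<le> size {#K \<in># M + replicate_mset k L. q \<in> K#}"
      proof (cases "q = p")
        case True
        have "{#K \<in># replicate_mset k L. p \<in> K#} = replicate_mset k L"
          using L by (induction k) auto
        with True show ?thesis by simp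
      next
        case False
        with q M show ?thesis by (auto simp: is_cover_def intro: trans_le_add1)
      qed
    qed
    then show ?thesis by blast
  qed
qed

end

theory Submission
  imports Defs
begin

text \<open>
  Lower bound: among the points on the two legs through the vertex (without the vertex itself) and
  on the hypotenuse, no admissible line meets more than two. There are \<open>3n - 4\<close> of them, each
  covered \<open>k\<close> times, so at least \<open>k (3n - 4) / 2\<close> lines are needed.

  Upper bound: with \<open>m\<close> about \<open>n / 2\<close>, the first \<open>m\<close> vertical and the first \<open>m\<close> horizontal lines
  missing the vertex cover all points off the legs; the remaining points of the legs are covered in
  pairs by \<open>n - 1 - m\<close> slanted lines. Repeat this cover \<open>k\<close> times.
\<close>

section \<open>Covering numbers and incidence counts\<close>

lemma cov_le:
  assumes "is_cover k H V M"
  shows "cov k H V \<le> size M"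
  unfolding cov_def using assms by (intro Least_le) blast

lemma cov_attained:
  assumes "finite H"
  obtains M where "is_cover k H V M" "size M = cov k H V"
proof -
  have "\<exists>m M. is_cover k H V M \<and> size M = m"
    using is_cover_exists[OF assms] by blast
  from LeastI_ex[OF this] show ?thesis
    using that unfolding cov_def by blast
qed

text \<open>Taking every line \<open>k\<close> times multiplies each incidence count by
  \<open>k\<close>. This reduces the upper bound to the case of simple covers.\<close>

lemma is_cover_repeat:
  assumes "is_cover 1 H V M"
  shows "is_cover k H V (repeat_mset k M)"
proof -
  have size_eq: "size (filter_mset P (repeat_mset k M)) = k * size (filter_mset P M)" for P
    by (induction k) simp_all
  have "k \<le> k * size {#L \<in># M. p \<in> L#}" if "p \<in> H - {V}" for p
  proof -
    have "1 \<le> size {#L \<in># M. p \<in> L#}"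
      using assms that unfolding is_cover_def by blast
    then show ?thesis by simp
  qed
  moreover have "L \<in># M" if "L \<in># repeat_mset k M" for L
    using that by (induction k) auto
  ultimately show ?thesis
    using assms unfolding is_cover_def size_eq by blast
qed

text \<open>Double counting: the left side counts incident pairs point by point. Counted line by
  line, each \<open>L\<close> in \<open>M\<close> contributes \<open>card (P \<inter> L)\<close>,
  which is at most \<open>d\<close>.\<close>

lemma sum_incidences_le:
  assumes "finite P" and "\<And>L. L \<in># M \<Longrightarrow> card (P \<inter> L) \<le> d"
  shows "(\<Sum>p\<in>P. size {#L \<in># M. p \<in> L#}) \<le> d * size M"
  using assms(2)
proof (induction M)
  case empty
  then show ?case by simp
next
  case (add K M)
  have "(\<Sum>p\<in>P. size {#L \<in># add_mset K M. p \<in> L#})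
      = (\<Sum>p\<in>P. (if p \<in> K then 1 else 0) + size {#L \<in># M. p \<in> L#})"
    by (intro sum.cong) auto
  also have "\<dots> = card (P \<inter> K) + (\<Sum>p\<in>P. size {#L \<in># M. p \<in> L#})"
    using assms(1) by (simp add: sum.distrib sum.If_cases Int_def)
  also have "\<dots> \<le> d + d * size M"
    using add by (intro add_mono) auto
  finally show ?case by simp
qed

section \<open>Equations of lines parallel to an axis\<close>

lemma affine_parallel_x_axisE:
  assumes "affine_parallel L x_axis"
  obtains c where "L = {p. snd p = c}"
proof -
  \<comment> \<open>Symmetry of parallelism is used to present \<open>L\<close> as a translate of
    the axis; only the second coordinate of the translation vector matters for the resulting
    set.\<close>
  obtain v where v: "L = (\<lambda>p. v + p) ` x_axis"
    using assms affine_parallel_commute unfolding affine_parallel_def by blast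
  have "L = {p. snd p = snd v}"
  proof
    show "L \<subseteq> {p. snd p = snd v}"
      unfolding v x_axis_def by auto
    show "{p. snd p = snd v} \<subseteq> L"
    proof
      fix p :: plane assume "p \<in> {p. snd p = snd v}"
      then have "p - v \<in> x_axis" unfolding x_axis_def by simp
      then show "p \<in> L" unfolding v by (intro image_eqI[of _ _ "p - v"]) auto
    qed
  qed
  then show ?thesis by (rule that)
qed

lemma affine_parallel_y_axisE:
  assumes "affine_parallel L y_axis"
  obtains c where "L = {p. fst p = c}"
proof -
  obtain v where v: "L = (\<lambda>p. v + p) ` y_axis"
    using assms affine_parallel_commute unfolding affine_parallel_def by blast
  have "L = {p. fst p = fst v}"
  proof
    show "L \<subseteq> {p. fst p = fst v}"
      unfolding v y_axis_def by auto
    show "{p. fst p = fst v} \<subseteq> L"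
    proof
      fix p :: plane assume "p \<in> {p. fst p = fst v}"
      then have "p - v \<in> y_axis" unfolding y_axis_def by simp
      then show "p \<in> L" unfolding v by (intro image_eqI[of _ _ "p - v"]) auto
    qed
  qed
  then show ?thesis by (rule that)
qed

section \<open>Lower bound: the legs and the hypotenuse\<close>

definition boundary_indices :: "nat \<Rightarrow> (nat \<times> nat) set" where
  "boundary_indices n =
     {(i, j). (i, j) \<noteq> (0, 0) \<and> i + j \<le> n - 1 \<and> (i = 0 \<or> j = 0 \<or> i + j = n - 1)}"

lemma finite_boundary_indices: "finite (boundary_indices n)"
  by (rule finite_subset[of _ "{..n} \<times> {..n}"]) (auto simp: boundary_indices_def)

lemma card_boundary_indices:
  assumes "n \<ge> 2"
  shows "card (boundary_indices n) = 3 * n - 4"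
proof -
  \<comment> \<open>\<open>?A\<close> and \<open>?B\<close> are the legs without the vertex.
    \<open>?C\<close> is the hypotenuse without its two endpoints, which already belong to the legs,
    so the three sets are disjoint and have \<open>(n-1) + (n-1) + (n-2)\<close> elements.\<close>
  let ?A = "(\<lambda>i. (i, 0::nat)) ` {1..n-1}"
  let ?B = "(\<lambda>j. (0::nat, j)) ` {1..n-1}"
  let ?C = "(\<lambda>i. (i, n - 1 - i)) ` {1..<n-1}"
  have "boundary_indices n = ?A \<union> ?B \<union> ?C"
  proof (intro equalityI subsetI)
    fix p assume "p \<in> boundary_indices n"
    then obtain i j where p: "p = (i, j)" and ij: "(i, j) \<noteq> (0, 0)" "i + j \<le> n - 1"
      "i = 0 \<or> j = 0 \<or> i + j = n - 1"
      unfolding boundary_indices_def by auto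
    have "i = 0 \<or> j = 0 \<or> i > 0 \<and> j > 0 \<and> j = n - 1 - i" using ij(3) by linarith
    then consider "i = 0" | "j = 0" | "i > 0" "j > 0" "j = n - 1 - i" by blast
    then show "p \<in> ?A \<union> ?B \<union> ?C"
      using p ij by cases auto
  next
    fix p assume "p \<in> ?A \<union> ?B \<union> ?C"
    then show "p \<in> boundary_indices n"
      unfolding boundary_indices_def by auto
  qed
  moreover have "card ?A = n - 1" "card ?B = n - 1" "card ?C = n - 2"
    by (subst card_image; auto simp: inj_on_def)+
  moreover have "?A \<inter> ?B = {}" "(?A \<union> ?B) \<inter> ?C = {}" by auto
  ultimately show ?thesis
    using assms by (simp add: card_Un_disjoint)
qed

definition grid_point :: "(nat \<Rightarrow> real) \<Rightarrow> (nat \<Rightarrow> real) \<Rightarrow> nat \<times> nat \<Rightarrow> plane" where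
  "grid_point a b = map_prod a b"

lemma boundary_points_in_half_grid:
  assumes "n > 0" and "inj_on a {..<n}" and "inj_on b {..<n}"
  shows "grid_point a b ` boundary_indices n \<subseteq> half_grid n a b - {(a 0, b 0)}"
proof
  fix p assume "p \<in> grid_point a b ` boundary_indices n"
  then obtain i j where p: "p = (a i, b j)" and ij: "(i, j) \<noteq> (0, 0)" "i + j \<le> n - 1"
    unfolding boundary_indices_def grid_point_def by auto
  have "a i = a 0 \<longleftrightarrow> i = 0" "b j = b 0 \<longleftrightarrow> j = 0"
    using ij assms by (auto dest: inj_onD)
  then show "p \<in> half_grid n a b - {(a 0, b 0)}"
    using p ij unfolding half_grid_def by auto
qed

lemma inj_on_grid_point:
  assumes "n > 0" and "inj_on a {..<n}" and "inj_on b {..<n}"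
  shows "inj_on (grid_point a b) (boundary_indices n)"
proof (rule inj_on_subset)
  show "inj_on (grid_point a b) ({..<n} \<times> {..<n})"
    unfolding grid_point_def by (rule map_prod_inj_on[OF assms(2,3)])
  show "boundary_indices n \<subseteq> {..<n} \<times> {..<n}"
    using assms(1) unfolding boundary_indices_def by auto
qed

text \<open>A line parallel to an axis and missing the vertex contains no leg; it meets the boundary
  in at most one point of the other leg and one of the hypotenuse. For all other lines genericity
  gives the bound.\<close>

lemma card_boundary_Int_line_le_2:
  assumes "n > 0" and inj: "inj_on a {..<n}" "inj_on b {..<n}"
    and gen: "generic (half_grid n a b)"
    and L: "is_line L" "(a 0, b 0) \<notin> L"
  shows "card (grid_point a b ` boundary_indices n \<inter> L) \<le> 2"
proof -
  let ?P = "grid_point a b ` boundary_indices n"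
  have sub: "?P \<subseteq> a ` {..<n} \<times> b ` {..<n}"
    using \<open>n > 0\<close> unfolding boundary_indices_def grid_point_def by auto
  have card2: "card ({u, v} :: plane set) \<le> 2" for u v
    by (simp add: card_insert_le_m1)
  consider (hor) "affine_parallel L x_axis" | (vert) "affine_parallel L y_axis"
    | (gen) "\<not> affine_parallel L x_axis" "\<not> affine_parallel L y_axis" by blast
  then show ?thesis
  proof cases
    case hor
    then obtain c where c: "L = {p. snd p = c}" by (rule affine_parallel_x_axisE)
    have "\<exists>u v. ?P \<inter> L \<subseteq> {u, v}"
    proof (cases "\<exists>j<n. b j = c")
      case True
      then obtain j where j: "j < n" "b j = c" by blast
      \<comment> \<open>Row 0 passes through the vertex, which \<open>L\<close> avoids; this rules
        out the one row that contains a whole leg.\<close>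
      have "j \<noteq> 0" using L c j by (cases j) auto
      \<comment> \<open>The leg point and the hypotenuse point of row \<open>j\<close>; they
        coincide if \<open>j = n - 1\<close>.\<close>
      have "?P \<inter> L \<subseteq> {(a 0, b j), (a (n - 1 - j), b j)}"
      proof
        fix p assume "p \<in> ?P \<inter> L"
        then obtain i j' where p: "p = (a i, b j')" "b j' = c" "i + j' \<le> n - 1"
          "i = 0 \<or> j' = 0 \<or> i + j' = n - 1"
          unfolding boundary_indices_def grid_point_def c by auto
        moreover have "j' = j"
          using p j \<open>n > 0\<close> by (intro inj_onD[OF inj(2)]) auto
        ultimately have "i = 0 \<or> i = n - 1 - j" using \<open>j \<noteq> 0\<close> by auto
        then show "p \<in> {(a 0, b j), (a (n - 1 - j), b j)}" using p \<open>j' = j\<close> by auto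
      qed
      then show ?thesis by blast
    next
      case False
      have "?P \<inter> L = {}"
        using False sub unfolding c by fastforce
      then show ?thesis by blast
    qed
    then obtain u v where "?P \<inter> L \<subseteq> {u, v}" by blast
    then have "card (?P \<inter> L) \<le> card {u, v}" by (intro card_mono) auto
    then show ?thesis using card2 le_trans by blast
  next
    case vert
    then obtain c where c: "L = {p. fst p = c}" by (rule affine_parallel_y_axisE)
    have "\<exists>u v. ?P \<inter> L \<subseteq> {u, v}"
    proof (cases "\<exists>i<n. a i = c")
      case True
      then obtain i where i: "i < n" "a i = c" by blast
      have "i \<noteq> 0" using L c i by (cases i) auto
      have "?P \<inter> L \<subseteq> {(a i, b 0), (a i, b (n - 1 - i))}"
      proof
        fix p assume "p \<in> ?P \<inter> L"
        then obtain i' j where p: "p = (a i', b j)" "a i' = c" "i' + j \<le> n - 1"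
          "i' = 0 \<or> j = 0 \<or> i' + j = n - 1"
          unfolding boundary_indices_def grid_point_def c by auto
        moreover have "i' = i"
          using p i \<open>n > 0\<close> by (intro inj_onD[OF inj(1)]) auto
        ultimately have "j = 0 \<or> j = n - 1 - i" using \<open>i \<noteq> 0\<close> by auto
        then show "p \<in> {(a i, b 0), (a i, b (n - 1 - i))}" using p \<open>i' = i\<close> by auto
      qed
      then show ?thesis by blast
    next
      case False
      have "?P \<inter> L = {}"
        using False sub unfolding c by fastforce
      then show ?thesis by blast
    qed
    then obtain u v where "?P \<inter> L \<subseteq> {u, v}" by blast
    then have "card (?P \<inter> L) \<le> card {u, v}" by (intro card_mono) auto
    then show ?thesis using card2 le_trans by blast
  next
    case gen
    have "card (?P \<inter> L) \<le> card (L \<inter> half_grid n a b)"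
      using boundary_points_in_half_grid[OF assms(1) inj]
      by (intro card_mono) (auto simp: finite_half_grid)
    also have "\<dots> \<le> 2"
      using gen L(1) assms(4) unfolding generic_def by blast
    finally show ?thesis .
  qed
qed

text \<open>Incidences between the boundary points and \<open>M\<close> are counted in two ways: at
  least \<open>k\<close> for each of the \<open>3 * n - 4\<close> points, at most 2 for each
  line.\<close>

lemma cover_size_lower_bound:
  assumes "n \<ge> 2" and inj: "inj_on a {..<n}" "inj_on b {..<n}"
    and gen: "generic (half_grid n a b)"
    and M: "is_cover k (half_grid n a b) (a 0, b 0) M"
  shows "(3 * n - 4) * k \<le> 2 * size M"
proof -
  let ?P = "grid_point a b ` boundary_indices n"
  have "n > 0" using assms(1) by simp
  have "(3 * n - 4) * k = (\<Sum>p\<in>?P. k)"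
    using card_image[OF inj_on_grid_point[OF \<open>n > 0\<close> inj]] card_boundary_indices[OF assms(1)]
    by simp
  also have "\<dots> \<le> (\<Sum>p\<in>?P. size {#L \<in># M. p \<in> L#})"
    using M boundary_points_in_half_grid[OF \<open>n > 0\<close> inj]
    unfolding is_cover_def by (intro sum_mono) blast
  also have "\<dots> \<le> 2 * size M"
    using M card_boundary_Int_line_le_2[OF \<open>n > 0\<close> inj gen] finite_boundary_indices
    unfolding is_cover_def by (intro sum_incidences_le) auto
  finally show ?thesis .
qed

section \<open>Upper bound: an explicit simple cover\<close>

lemma single_cover_exists:
  assumes "n > 0" and inj: "inj_on a {..<n}" "inj_on b {..<n}"
  shows "\<exists>M. is_cover 1 (half_grid n a b) (a 0, b 0) M \<and> size M = n - 1 + (n - 1) div 2"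
proof -
  \<comment> \<open>The least \<open>m\<close> with \<open>n - 1 \<le> 2 * m + 1\<close>, so that
    the two indices of a grid point cannot both exceed \<open>m\<close>.\<close>
  define m where "m = (n - 1) div 2"
  define X :: "nat \<Rightarrow> plane set" where "X i = {p. (1, 0) \<bullet> p = a i}" for i
  define Y :: "nat \<Rightarrow> plane set" where "Y j = {p. (0, 1) \<bullet> p = b j}" for j
  \<comment> \<open>The line through \<open>(a i, b 0)\<close> and \<open>(a 0, b i)\<close>,
    pairing the \<open>i\<close>-th points of the two legs.\<close>
  define Z :: "nat \<Rightarrow> plane set" where
    "Z i = {p. (b i - b 0, a i - a 0) \<bullet> p = a i * b i - a 0 * b 0}" for i
  define M where "M = image_mset X (mset_set {1..m}) + image_mset Y (mset_set {1..m})
    + image_mset Z (mset_set {m+1..n-1})"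
  have set_M: "set_mset M = X ` {1..m} \<union> Y ` {1..m} \<union> Z ` {m+1..n-1}"
    unfolding M_def by auto
  have ne: "a i \<noteq> a 0" "b i \<noteq> b 0" if "1 \<le> i" "i \<le> n - 1" for i
    using that \<open>n > 0\<close> inj by (auto dest: inj_onD)
  have "m \<le> n - 1" unfolding m_def by simp
  have "is_line L \<and> (a 0, b 0) \<notin> L" if "L \<in># M" for L
  proof -
    from that consider i where "L = X i" "1 \<le> i" "i \<le> m" | j where "L = Y j" "1 \<le> j" "j \<le> m"
      | i where "L = Z i" "m + 1 \<le> i" "i \<le> n - 1"
      unfolding set_M by auto
    then show ?thesis
    proof cases
      case 1
      then have "(a 0, b 0) \<notin> L" using ne[of i] \<open>m \<le> n - 1\<close> by (auto simp: X_def)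
      moreover have "is_line L"
        unfolding 1 X_def by (rule is_line_hyperplane) (simp add: zero_prod_def)
      ultimately show ?thesis by simp
    next
      case 2
      then have "(a 0, b 0) \<notin> L" using ne[of j] \<open>m \<le> n - 1\<close> by (auto simp: Y_def)
      moreover have "is_line L"
        unfolding 2 Y_def by (rule is_line_hyperplane) (simp add: zero_prod_def)
      ultimately show ?thesis by simp
    next
      case 3
      have nz: "a i \<noteq> a 0" "b i \<noteq> b 0" using ne[of i] 3 by auto
      \<comment> \<open>At the vertex, the two sides of the equation of \<open>Z i\<close> differ by
        exactly this product.\<close>
      then have "(a i - a 0) * (b i - b 0) \<noteq> 0" by simp
      then have "(a 0, b 0) \<notin> L"
        unfolding 3 Z_def by (auto simp: algebra_simps)
      moreover have "is_line L"
        unfolding 3 Z_def using nz by (intro is_line_hyperplane) (simp add: zero_prod_def)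
      ultimately show ?thesis by simp
    qed
  qed
  moreover have "1 \<le> size {#L \<in># M. p \<in> L#}" if p: "p \<in> half_grid n a b - {(a 0, b 0)}" for p
  proof -
    obtain i j where ij: "p = (a i, b j)" "i + j \<le> n - 1"
      using p unfolding half_grid_def by blast
    have nz: "(i, j) \<noteq> (0, 0)" using p ij(1) by (cases i; cases j) auto
    \<comment> \<open>If both indices were at least \<open>m + 1\<close>, their sum would be at
      least \<open>2 * m + 2\<close>. Hence a point missed by all \<open>X\<close> and
      \<open>Y\<close> lines has one index 0 and the other above \<open>m\<close>, and a
      \<open>Z\<close> line covers it.\<close>
    have "i + j \<le> 2 * m + 1" using ij(2) unfolding m_def by linarith
    then consider "1 \<le> i" "i \<le> m" | "1 \<le> j" "j \<le> m" | "j = 0" "m + 1 \<le> i" | "i = 0" "m + 1 \<le> j"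
      using nz by (cases "i = 0"; cases "j = 0") (force simp: not_le)+
    then have "\<exists>L\<in>#M. p \<in> L"
    proof cases
      case 1
      then have "X i \<in># M" "p \<in> X i" unfolding set_M by (auto simp: X_def ij)
      then show ?thesis by blast
    next
      case 2
      then have "Y j \<in># M" "p \<in> Y j" unfolding set_M by (auto simp: Y_def ij)
      then show ?thesis by blast
    next
      case 3
      then have "Z i \<in># M" "p \<in> Z i"
        using ij(2) unfolding set_M by (auto simp: Z_def ij(1) algebra_simps)
      then show ?thesis by blast
    next
      case 4
      then have "Z j \<in># M" "p \<in> Z j"
        using ij(2) unfolding set_M by (auto simp: Z_def ij(1) algebra_simps)
      then show ?thesis by blast
    qed
    then have "{#L \<in># M. p \<in> L#} \<noteq> {#}" by auto
    then show ?thesis unfolding nonempty_has_size by simp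
  qed
  moreover have "size M = n - 1 + m" using \<open>m \<le> n - 1\<close> unfolding M_def by simp
  ultimately show ?thesis unfolding is_cover_def m_def by blast
qed

section \<open>Both bounds for the covering number\<close>

theorem theorem1p4:
  fixes n k :: nat and a b :: "nat \<Rightarrow> real"
  assumes "n > 0" and "k > 0"
    and "strict_mono_on {..<n} a" and "strict_mono_on {..<n} b"
    and "generic (half_grid n a b)"
  shows "3 * real n * real k / 2 - 2 * real k \<le> real (cov k (half_grid n a b) (a 0, b 0)) \<and>
         real (cov k (half_grid n a b) (a 0, b 0)) \<le> 3 * real n * real k / 2 + real k / 2"
proof
  let ?c = "cov k (half_grid n a b) (a 0, b 0)"
  have inj: "inj_on a {..<n}" "inj_on b {..<n}"
    using assms(3,4) by (auto intro: strict_mono_on_imp_inj_on)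
  show "3 * real n * real k / 2 - 2 * real k \<le> real ?c"
  proof (cases "n \<ge> 2")
    case True
    obtain M where M: "is_cover k (half_grid n a b) (a 0, b 0) M" "size M = ?c"
      using cov_attained[OF finite_half_grid] by blast
    have "(3 * n - 4) * k \<le> 2 * ?c"
      using cover_size_lower_bound[OF True inj assms(5) M(1)] M(2) by simp
    then have "real ((3 * n - 4) * k) \<le> real (2 * ?c)" by (rule of_nat_mono)
    \<comment> \<open>Since \<open>n \<ge> 2\<close>, the natural subtraction
      \<open>3 * n - 4\<close> does not truncate and carries over to the reals.\<close>
    then have "(3 * real n - 4) * real k \<le> 2 * real ?c"
      using True by (simp add: of_nat_diff)
    then show ?thesis by (simp add: algebra_simps)
  next
    case False
    \<comment> \<open>Here the claimed lower bound equals \<open>- k / 2\<close>, which is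
      negative.\<close>
    then have "n = 1" using assms(1) by simp
    then show ?thesis by simp
  qed
  obtain M where M: "is_cover 1 (half_grid n a b) (a 0, b 0) M"
    and size_M: "size M = n - 1 + (n - 1) div 2"
    using single_cover_exists[OF assms(1) inj] by blast
  \<comment> \<open>The construction even gives \<open>2 * size M \<le> 3 * n - 3\<close>; doubling
    keeps the halves of the claim out of the natural-number arithmetic.\<close>
  have "2 * size M \<le> 3 * n + 1" unfolding size_M by presburger
  have "?c \<le> k * size M"
    using cov_le[OF is_cover_repeat[OF M]] by simp
  then have "2 * ?c \<le> k * (2 * size M)" by simp
  also have "\<dots> \<le> k * (3 * n + 1)"
    using \<open>2 * size M \<le> 3 * n + 1\<close> by (rule mult_le_mono2)
  finally have "real (2 * ?c) \<le> real (k * (3 * n + 1))" by (rule of_nat_mono)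
  then show "real ?c \<le> 3 * real n * real k / 2 + real k / 2"
    by (simp add: algebra_simps)
qed

end
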